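(* Let $f \colon \mathbb{R}^n \to \mathbb{R} \cup \{+\infty\}$ be lower semi-continuous and let $C \subset \mathbb{R}^n$ be an unbounded closed set. Assume that one of the following conditions holds: (i) $D^{\uparrow}_{f}(\infty) \cap \mathrm{int}\, T_{C}(\infty_{I}) \ne \emptyset$; (ii) $\mathrm{int}\, D^{\uparrow}_{f}(\infty) \cap T_{C}(\infty_{I}) \ne \emptyset$. If there exists a sequence $x_k \in C$ such that $\|x_k\| \to \infty$ and $f(x_k) \to \inf_{x \in C} f(x) > -\infty$, then the following optimality conditions hold: $$0 \in \partial f(\infty) + N_{C}(\infty_{I}), \qquad f^{\uparrow}(\infty; v) \ge 0 \quad \text{for all } v \in T_C(\infty_I).$$
   Context: $\mathbb{R}^n$ carries the Euclidean norm and inner product; $\mathbb{B}_\epsilon(v)$ is the closed ball of radius $\epsilon$ centered at $v$; $\mathrm{int}$ denotes the interior; $t_k \searrow 0$ means $t_k>0$ and $t_k$ decreases to $0$. $I = \{1,\ldots,n\}$. For an unbounded set $C \subset \mathbb{R}^n$: $T_C(\infty_I)$ is the set of all $v \in \mathbb{R}^n$ such that for all sequences $x_k \in C$ with $\|x_k\|\to\infty$ and $t_k \searrow 0$ there exists $v_k \to v$ with $x_k + t_k v_k \in C$ for all $k$; and $N_C(\infty_I) := \{w \in \mathbb{R}^n \mid \langle v, w\rangle \le 0 \text{ for all } v \in T_C(\infty_I)\}$. For $f \colon \mathbb{R}^n \to \mathbb{R}\cup\{+\infty\}$, whose effective domain $\mathrm{dom} f := \{x \mid f(x) < \infty\}$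 is assumed throughout to be unbounded, let $\mathrm{epi} f := \{(x,y) \in \mathbb{R}^n\times\mathbb{R} \mid f(x)\le y\}$. $T_{\mathrm{epi} f}(\infty_I)$ is the set of all $(v,r) \in \mathbb{R}^n\times\mathbb{R}$ such that for all sequences $(x_k,y_k)\in \mathrm{epi} f$ with $\|x_k\|\to\infty$ and $t_k\searrow 0$ there exists $(v_k,r_k)\to(v,r)$ with $(x_k,y_k)+t_k(v_k,r_k)\in\mathrm{epi} f$ for all $k$; $N_{\mathrm{epi} f}(\infty_I) := \{w \in \mathbb{R}^{n}\times\mathbb{R} \mid \langle z, w\rangle\le 0 \text{ for all } z \in T_{\mathrm{epi} f}(\infty_I)\}$. The set of subgradients of $f$ at infinity is $\partial f(\infty) := \{\xi\in\mathbb{R}^n \mid (\xi,-1)\in N_{\mathrm{epi} f}(\infty_I)\}$. The upper subderivative at infinity is $$f^{\uparrow}(\infty; v) := \lim_{\epsilon \searrow 0}\ \limsup_{\|x\|\to\infty,\ x \in \mathrm{dom} f,\ t \searrow 0}\ \inf_{w \in \mathbb{B}_\epsilon(v)} \frac{f(x + t w) - f(x)}{t} \in [-\infty,+\infty],$$ and $D^{\uparrow}_{f}(\infty) := \{ v \in \mathbb{R}^n \mid f^{\uparrow}(\infty; v) < +\infty\}$.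
   Formalization: The formal theorem also assumes that C meets dom f, so that inf over C of f is finite; without this the claim fails, e.g. for n=1, C=[0,∞), f(x)=x for x ≤ -1 and +∞ otherwise. *)

theory Defs
  imports "HOL-Analysis.Analysis"
begin

text \<open>Functions with values in the reals extended by \<open>+\<infinity>\<close> are rendered as functions into
  \<^typ>\<open>ereal\<close> that never take the value \<open>-\<infinity>\<close>; that side condition is an assumption of the theorem.\<close>

definition eff_dom :: "('a \<Rightarrow> ereal) \<Rightarrow> 'a set" where
  "eff_dom f = {x. f x < \<infinity>}"

definition epi :: "('a \<Rightarrow> ereal) \<Rightarrow> ('a \<times> real) set" where
  "epi f = {(x, y). f x \<le> ereal y}"

definition lower_semicontinuous :: "('a::topological_space \<Rightarrow> ereal) \<Rightarrow> bool" where
  "lower_semicontinuous f \<longleftrightarrow> (\<forall>x. f x \<le> Liminf (nhds x) f)"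

definition decreases_to_zero :: "(nat \<Rightarrow> real) \<Rightarrow> bool" where
  "decreases_to_zero t \<longleftrightarrow> (\<forall>k. 0 < t k) \<and> decseq t \<and> t \<longlonglongrightarrow> 0"

definition tangent_cone_inf :: "'a::real_normed_vector set \<Rightarrow> 'a set" where
  "tangent_cone_inf C = {v. \<forall>x t.
     (\<forall>k. x k \<in> C) \<and> filterlim (\<lambda>k. norm (x k)) at_top sequentially \<and> decreases_to_zero t \<longrightarrow>
     (\<exists>u. u \<longlonglongrightarrow> v \<and> (\<forall>k. x k + t k *\<^sub>R u k \<in> C))}"

text \<open>For a set in a product, such as an epigraph, only the first component of the base points is
  required to go to infinity; the last coordinate is unrestricted.\<close>

definition tangent_cone_inf_fst ::
    "('a::real_normed_vector \<times> real) set \<Rightarrow> ('a \<times> real) set" where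
  "tangent_cone_inf_fst E = {z. \<forall>p t.
     (\<forall>k. p k \<in> E) \<and> filterlim (\<lambda>k. norm (fst (p k))) at_top sequentially \<and> decreases_to_zero t \<longrightarrow>
     (\<exists>q. q \<longlonglongrightarrow> z \<and> (\<forall>k. p k + t k *\<^sub>R q k \<in> E))}"

definition polar_cone :: "'a::real_inner set \<Rightarrow> 'a set" where
  "polar_cone T = {w. \<forall>v\<in>T. v \<bullet> w \<le> 0}"

definition normal_cone_inf :: "'a::real_inner set \<Rightarrow> 'a set" where
  "normal_cone_inf C = polar_cone (tangent_cone_inf C)"

definition normal_cone_inf_fst :: "('a::real_inner \<times> real) set \<Rightarrow> ('a \<times> real) set" where
  "normal_cone_inf_fst E = polar_cone (tangent_cone_inf_fst E)"

definition subdiff_inf :: "('a::real_inner \<Rightarrow> ereal) \<Rightarrow> 'a set" where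
  "subdiff_inf f = {\<xi>. (\<xi>, -1) \<in> normal_cone_inf_fst (epi f)}"

text \<open>The joint upper limit over \<open>\<parallel>x\<parallel> \<rightarrow> \<infinity>\<close>, \<open>x \<in> dom f\<close>, \<open>t \<searrow> 0\<close> is taken along a product
  filter. Along it \<open>f x\<close> is finite and \<open>t > 0\<close>, so the difference quotient is never \<open>\<infinity> - \<infinity>\<close>.\<close>

definition upper_subderiv_inf_at ::
    "('a::real_normed_vector \<Rightarrow> ereal) \<Rightarrow> 'a \<Rightarrow> real \<Rightarrow> ereal" where
  "upper_subderiv_inf_at f v \<epsilon> =
     Limsup (inf at_infinity (principal (eff_dom f)) \<times>\<^sub>F at_right (0::real))
       (\<lambda>(x, t). INF w\<in>cball v \<epsilon>. (f (x + t *\<^sub>R w) - f x) / ereal t)"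

definition upper_subderiv_inf :: "('a::real_normed_vector \<Rightarrow> ereal) \<Rightarrow> 'a \<Rightarrow> ereal" where
  "upper_subderiv_inf f v = Lim (at_right 0) (upper_subderiv_inf_at f v)"

definition upper_subderiv_dom :: "('a::real_normed_vector \<Rightarrow> ereal) \<Rightarrow> 'a set" where
  "upper_subderiv_dom f = {v. upper_subderiv_inf f v < \<infinity>}"

text \<open>The operator \<^const>\<open>Lim\<close> is only meaningful where the limit exists; here it always does,
  by monotonicity in \<open>\<epsilon>\<close>.\<close>

lemma upper_subderiv_inf_at_antimono:
  assumes "\<delta> \<le> \<epsilon>"
  shows "upper_subderiv_inf_at f v \<epsilon> \<le> upper_subderiv_inf_at f v \<delta>"
  unfolding upper_subderiv_inf_at_def using assms
  by (intro Limsup_mono always_eventually)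
     (auto intro!: INF_superset_mono simp: subset_cball)

lemma tendsto_upper_subderiv_inf:
  "(upper_subderiv_inf_at f v \<longlongrightarrow> upper_subderiv_inf f v) (at_right 0)"
  and upper_subderiv_inf_eq_SUP:
  "upper_subderiv_inf f v = (SUP \<epsilon>\<in>{0<..}. upper_subderiv_inf_at f v \<epsilon>)"
proof -
  let ?g = "upper_subderiv_inf_at f v"
  have lim: "(?g \<longlongrightarrow> (SUP \<epsilon>\<in>{0<..}. ?g \<epsilon>)) (at_right 0)"
  proof (rule order_tendstoI)
    fix a assume "a < (SUP \<epsilon>\<in>{0<..}. ?g \<epsilon>)"
    then obtain e where e: "e > 0" "a < ?g e"
      by (auto simp: less_SUP_iff)
    show "eventually (\<lambda>x. a < ?g x) (at_right 0)"
      unfolding eventually_at_right_field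
      using e upper_subderiv_inf_at_antimono[of _ e f v]
      by (intro exI[of _ e]) (auto intro: less_le_trans)
  next
    fix a assume a: "(SUP \<epsilon>\<in>{0<..}. ?g \<epsilon>) < a"
    show "eventually (\<lambda>x. ?g x < a) (at_right 0)"
      unfolding eventually_at_right_field
      by (intro exI[of _ 1]) (auto intro!: le_less_trans[OF _ a] SUP_upper)
  qed
  then show "upper_subderiv_inf f v = (SUP \<epsilon>\<in>{0<..}. ?g \<epsilon>)"
    unfolding upper_subderiv_inf_def by (intro tendsto_Lim) auto
  with lim show "(?g \<longlongrightarrow> upper_subderiv_inf f v) (at_right 0)" by simp
qed

end

theory Submission
  imports Defs
begin

text \<open>Let \<open>E\<close> be the tangent cone at infinity of the epigraph and \<open>T\<close> that of \<open>C\<close>; both are convex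
  cones, and \<open>E\<close> contains \<open>(v, r)\<close> whenever \<open>r\<close> exceeds the upper subderivative at \<open>v\<close>. If
  \<open>(v, r) \<in> E\<close> with \<open>v \<in> T\<close> and \<open>r < 0\<close>, the qualification condition lets one perturb \<open>(v, r)\<close> so
  that, keeping \<open>r < 0\<close>, one of the two tangencies becomes interior. Interior tangent directions may
  be followed exactly, so a single small step from far out on the minimizing sequence stays in \<open>C\<close>
  and decreases \<open>f\<close> by a fixed amount, below its infimum. Hence \<open>r \<ge> 0\<close>, which is the second
  conclusion; separating \<open>E\<close> from \<open>T \<times> {..<0}\<close> gives the first.\<close>

section \<open>A uniform description of the tangent cones at infinity\<close>

text \<open>The function \<open>g\<close> measures remoteness: \<open>norm\<close> gives the cone of
  \<open>C\<close>, the norm of the first component that of an epigraph, so both are treated at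
  once. The threshold and the step bound are uniform in the base point, which is what permits steps
  of fixed length later.\<close>

definition tangent_cone_along :: "('a::real_normed_vector \<Rightarrow> real) \<Rightarrow> 'a set \<Rightarrow> 'a set" where
  "tangent_cone_along g C = {v. \<forall>\<epsilon>>0. \<exists>R. \<exists>\<delta>>0. \<forall>x\<in>C. \<forall>t. R < g x \<longrightarrow> 0 < t \<longrightarrow> t < \<delta> \<longrightarrow>
     (\<exists>u. dist u v < \<epsilon> \<and> x + t *\<^sub>R u \<in> C)}"

lemma tangent_cone_alongD:
  assumes "v \<in> tangent_cone_along g C" "\<epsilon> > 0"
  shows "\<exists>R \<delta>. \<delta> > 0 \<and> (\<forall>x t. x \<in> C \<longrightarrow> R < g x \<longrightarrow> 0 < t \<longrightarrow> t < \<delta> \<longrightarrow>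
    (\<exists>u. dist u v < \<epsilon> \<and> x + t *\<^sub>R u \<in> C))"
  using assms unfolding tangent_cone_along_def by blast

text \<open>Forwards, \<open>u k\<close> is an almost nearest point to \<open>v\<close> among the
  admissible directions at step \<open>k\<close>, and the uniform condition drives its distance to
  0. Backwards, if some tolerance fails at every threshold, the bad points and steps form a sequence
  with no admissible directions tending to \<open>v\<close>.\<close>

lemma tangent_cone_along_sequential:
  fixes C :: "'a::real_normed_vector set"
  shows "v \<in> tangent_cone_along g C \<longleftrightarrow>
    (\<forall>x t. (\<forall>k. x k \<in> C) \<and> filterlim (\<lambda>k. g (x k)) at_top sequentially \<and> decreases_to_zero t \<longrightarrow>
      (\<exists>u. u \<longlonglongrightarrow> v \<and> (\<forall>k. x k + t k *\<^sub>R u k \<in> C)))" (is "?L \<longleftrightarrow> ?R")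
proof
  assume v: ?L
  show ?R
  proof (intro allI impI)
    fix x :: "nat \<Rightarrow> 'a" and t :: "nat \<Rightarrow> real"
    assume "(\<forall>k. x k \<in> C) \<and> filterlim (\<lambda>k. g (x k)) at_top sequentially \<and> decreases_to_zero t"
    then have x: "\<And>k. x k \<in> C" and gx: "filterlim (\<lambda>k. g (x k)) at_top sequentially"
      and t: "\<And>k. 0 < t k" "t \<longlonglongrightarrow> 0" by (auto simp: decreases_to_zero_def)
    define A where "A k = {u. x k + t k *\<^sub>R u \<in> C}" for k
    \<comment> \<open>\<open>infdist\<close> to the empty set is 0 by convention, so nonemptiness is
      needed; the zero direction is always admissible.\<close>
    have ne: "A k \<noteq> {}" for k
      using x[of k] by (auto simp: A_def intro!: exI[of _ 0])
    \<comment> \<open>\<open>C\<close> is arbitrary, so a nearest direction may not exist; the slack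
      1/(k+1) replaces it.\<close>
    have ex: "\<exists>u\<in>A k. dist v u < infdist v (A k) + 1 / real (Suc k)" for k
    proof (rule ccontr)
      assume "\<not> ?thesis"
      then have "infdist v (A k) + 1 / real (Suc k) \<le> infdist v (A k)"
        using ne[of k] by (subst (2) infdist_def) (auto intro!: cINF_greatest simp: not_less)
      then show False by (simp add: field_simps)
    qed
    then have "\<forall>k. \<exists>u. u \<in> A k \<and> dist v u < infdist v (A k) + 1 / real (Suc k)" by blast
    from choice[OF this] obtain u where u: "\<And>k. u k \<in> A k"
      "\<And>k. dist v (u k) < infdist v (A k) + 1 / real (Suc k)" by blast
    have "(\<lambda>k. infdist v (A k)) \<longlonglongrightarrow> 0"
    proof (rule LIMSEQ_I)
      fix e :: real assume "e > 0"
      obtain R \<delta> where R: "\<delta> > 0"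
        "\<And>x t. \<lbrakk>x \<in> C; R < g x; 0 < t; t < \<delta>\<rbrakk> \<Longrightarrow> \<exists>u. dist u v < e \<and> x + t *\<^sub>R u \<in> C"
        using tangent_cone_alongD[OF v \<open>e > 0\<close>] by metis
      have "eventually (\<lambda>k. R < g (x k)) sequentially"
        using gx by (simp add: filterlim_at_top_dense)
      moreover have "eventually (\<lambda>k. t k < \<delta>) sequentially"
        using t(2) R(1) order_tendstoD(2) by blast
      ultimately have "eventually (\<lambda>k. norm (infdist v (A k) - 0) < e) sequentially"
      proof eventually_elim
        case (elim k)
        then obtain u' where "dist u' v < e" "u' \<in> A k"
          using R(2)[OF x[of k]] t(1) by (auto simp: A_def)
        then have "infdist v (A k) < e"
          by (metis dist_commute infdist_le le_less_trans)
        then show ?case by (simp add: infdist_nonneg)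
      qed
      then show "\<exists>no. \<forall>n\<ge>no. norm (infdist v (A n) - 0) < e"
        by (simp add: eventually_sequentially)
    qed
    then have lim: "(\<lambda>k. infdist v (A k) + 1 / real (Suc k)) \<longlonglongrightarrow> 0 + 0"
      by (intro tendsto_add LIMSEQ_Suc[OF lim_1_over_n])
    have "(\<lambda>k. dist (u k) v) \<longlonglongrightarrow> 0"
    proof (rule tendsto_sandwich[OF _ _ tendsto_const])
      show "eventually (\<lambda>k. dist (u k) v \<le> infdist v (A k) + 1 / real (Suc k)) sequentially"
        using u(2) by (intro always_eventually) (auto simp: dist_commute less_imp_le)
    qed (use lim in auto)
    then show "\<exists>u. u \<longlonglongrightarrow> v \<and> (\<forall>k. x k + t k *\<^sub>R u k \<in> C)"
      using u(1) tendsto_dist_iff[of u v sequentially] by (auto simp: A_def)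
  qed
next
  assume R: ?R
  show ?L
  proof (rule ccontr)
    assume "\<not> ?L"
    then have "\<exists>\<epsilon>>0. \<forall>R \<delta>. \<delta> > 0 \<longrightarrow>
        (\<exists>x\<in>C. \<exists>t. R < g x \<and> 0 < t \<and> t < \<delta> \<and> (\<forall>u. dist u v < \<epsilon> \<longrightarrow> x + t *\<^sub>R u \<notin> C))"
      by (simp add: tangent_cone_along_def)
    then obtain \<epsilon> where "\<epsilon> > 0" and
      bad: "\<forall>R \<delta>. \<delta> > 0 \<longrightarrow>
        (\<exists>x\<in>C. \<exists>t. R < g x \<and> 0 < t \<and> t < \<delta> \<and> (\<forall>u. dist u v < \<epsilon> \<longrightarrow> x + t *\<^sub>R u \<notin> C))"
      by (elim exE conjE)
    define P where "P n p \<longleftrightarrow> fst p \<in> C \<and> real n < g (fst p) \<and> 0 < snd p \<and>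
      snd p < 1 / real (Suc n) \<and> (\<forall>u. dist u v < \<epsilon> \<longrightarrow> fst p + snd p *\<^sub>R u \<notin> C)" for n p
    \<comment> \<open>Dependent choice, since the step sizes must be monotone and not only tend to
      0.\<close>
    have "\<exists>p. \<forall>n. P n (p n) \<and> snd (p (Suc n)) \<le> snd (p n)"
    proof (rule dependent_nat_choice)
      show "\<exists>p. P 0 p" using bad[rule_format, of 1 0] by (auto simp: P_def)
    next
      fix p n assume "P n p"
      then have "min (snd p) (1 / real (Suc (Suc n))) > 0" by (auto simp: P_def)
      from bad[rule_format, OF this, of "real (Suc n)"]
      show "\<exists>q. P (Suc n) q \<and> snd q \<le> snd p" by (fastforce simp: P_def)
    qed
    then obtain p where p: "\<And>n. P n (p n)" "\<And>n. snd (p (Suc n)) \<le> snd (p n)" by blast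
    have "(\<lambda>n. snd (p n)) \<longlonglongrightarrow> 0"
    proof (rule tendsto_sandwich)
      show "eventually (\<lambda>n. snd (p n) \<le> 1 / real (Suc n)) sequentially"
        using p(1) by (intro always_eventually) (auto simp: P_def less_imp_le)
      show "eventually (\<lambda>n. 0 \<le> snd (p n)) sequentially"
        using p(1) by (intro always_eventually) (auto simp: P_def less_imp_le)
      show "(\<lambda>n. 1 / real (Suc n)) \<longlonglongrightarrow> 0" by (rule LIMSEQ_Suc[OF lim_1_over_n])
    qed auto
    then have "decreases_to_zero (\<lambda>n. snd (p n))"
      using p by (auto simp: decreases_to_zero_def P_def decseq_Suc_iff)
    moreover have "filterlim (\<lambda>n. g (fst (p n))) at_top sequentially"
      by (rule filterlim_at_top_mono[OF filterlim_real_sequentially])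
        (use p(1) in \<open>auto simp: P_def less_imp_le\<close>)
    ultimately obtain u where "u \<longlonglongrightarrow> v" "\<And>n. fst (p n) + snd (p n) *\<^sub>R u n \<in> C"
      using R[rule_format, of "\<lambda>n. fst (p n)" "\<lambda>n. snd (p n)"] p(1) by (auto simp: P_def)
    moreover from \<open>u \<longlonglongrightarrow> v\<close> obtain n where "dist (u n) v < \<epsilon>"
      using \<open>\<epsilon> > 0\<close> by (metis lim_sequentially order_refl)
    ultimately show False using p(1)[of n] by (auto simp: P_def)
  qed
qed

lemma tangent_cone_inf_eq_along: "tangent_cone_inf C = tangent_cone_along norm C"
  unfolding tangent_cone_inf_def set_eq_iff mem_Collect_eq tangent_cone_along_sequential by blast

lemma tangent_cone_inf_fst_eq_along:
  "tangent_cone_inf_fst E = tangent_cone_along (\<lambda>p. norm (fst p)) E"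
  unfolding tangent_cone_inf_fst_def set_eq_iff mem_Collect_eq tangent_cone_along_sequential
  by blast

text \<open>For a sum, take one step near \<open>u\<close> and then one near \<open>v\<close> from
  the point reached; the Lipschitz bound on \<open>g\<close> keeps that point remote. For a
  multiple, a step \<open>t\<close> along \<open>c *\<^sub>R v\<close> is a step
  \<open>t * c\<close> along \<open>v\<close>.\<close>

lemma convex_cone_tangent_cone_along:
  fixes C :: "'a::real_normed_vector set"
  assumes g: "\<And>x y. g x \<le> g y + norm (x - y)"
  shows "convex_cone (tangent_cone_along g C)"
  unfolding convex_cone_iff
proof (intro conjI ballI allI impI)
  show "0 \<in> tangent_cone_along g C"
    by (auto simp: tangent_cone_along_def intro!: exI[of _ "0::'a"] exI[of _ "1::real"])
next
  fix u v assume uv: "u \<in> tangent_cone_along g C" "v \<in> tangent_cone_along g C"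
  show "u + v \<in> tangent_cone_along g C"
    unfolding tangent_cone_along_def
  proof (intro CollectI allI impI)
    fix \<epsilon> :: real assume "\<epsilon> > 0"
    then have "\<epsilon>/2 > 0" by simp
    obtain R1 \<delta>1 where 1: "\<delta>1 > 0"
      "\<And>x t. \<lbrakk>x \<in> C; R1 < g x; 0 < t; t < \<delta>1\<rbrakk> \<Longrightarrow> \<exists>w. dist w u < \<epsilon>/2 \<and> x + t *\<^sub>R w \<in> C"
      using tangent_cone_alongD[OF uv(1) \<open>\<epsilon>/2 > 0\<close>] by metis
    obtain R2 \<delta>2 where 2: "\<delta>2 > 0"
      "\<And>x t. \<lbrakk>x \<in> C; R2 < g x; 0 < t; t < \<delta>2\<rbrakk> \<Longrightarrow> \<exists>w. dist w v < \<epsilon>/2 \<and> x + t *\<^sub>R w \<in> C"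
      using tangent_cone_alongD[OF uv(2) \<open>\<epsilon>/2 > 0\<close>] by metis
    show "\<exists>R. \<exists>\<delta>>0. \<forall>x\<in>C. \<forall>t. R < g x \<longrightarrow> 0 < t \<longrightarrow> t < \<delta> \<longrightarrow>
        (\<exists>w. dist w (u + v) < \<epsilon> \<and> x + t *\<^sub>R w \<in> C)"
    \<comment> \<open>Since t < 1, the first step has length at most
      \<open>norm u + \<epsilon>\<close>, so it cannot bring \<open>g\<close> down to
      \<open>R2\<close>.\<close>
    proof (rule exI[of _ "max R1 (R2 + norm u + \<epsilon>)"], rule exI[of _ "min 1 (min \<delta>1 \<delta>2)"],
        intro conjI ballI allI impI)
      fix x t assume x: "x \<in> C" and gx: "max R1 (R2 + norm u + \<epsilon>) < g x"
        and t: "0 < t" "t < min 1 (min \<delta>1 \<delta>2)"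
      then obtain w1 where w1: "dist w1 u < \<epsilon>/2" "x + t *\<^sub>R w1 \<in> C"
        using 1(2)[OF x, of t] by auto
      have "norm w1 \<le> norm u + \<epsilon>"
        using w1(1) norm_triangle_ineq[of u "w1 - u"] \<open>\<epsilon> > 0\<close> by (simp add: dist_norm)
      moreover have "t * norm w1 \<le> 1 * norm w1" using t by (intro mult_right_mono) auto
      moreover have "g x \<le> g (x + t *\<^sub>R w1) + t * norm w1"
        using g[of x "x + t *\<^sub>R w1"] t by simp
      ultimately have "R2 < g (x + t *\<^sub>R w1)" using gx by simp
      then obtain w2 where w2: "dist w2 v < \<epsilon>/2" "x + t *\<^sub>R w1 + t *\<^sub>R w2 \<in> C"
        using 2(2)[OF w1(2), of t] t by auto
      have "dist (w1 + w2) (u + v) \<le> dist w1 u + dist w2 v"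
        by (rule dist_triangle_add)
      then show "\<exists>w. dist w (u + v) < \<epsilon> \<and> x + t *\<^sub>R w \<in> C"
        using w1 w2 by (intro exI[of _ "w1 + w2"]) (auto simp: algebra_simps)
    qed (use 1 2 in auto)
  qed
next
  fix v and c :: real assume v: "v \<in> tangent_cone_along g C" and "0 \<le> c"
  show "c *\<^sub>R v \<in> tangent_cone_along g C"
  proof (cases "c = 0")
    case True
    then show ?thesis
      by (auto simp: tangent_cone_along_def intro!: exI[of _ "0::'a"] exI[of _ "1::real"])
  next
    case False
    with \<open>0 \<le> c\<close> have c: "c > 0" by simp
    show ?thesis
      unfolding tangent_cone_along_def
    proof (intro CollectI allI impI)
      fix \<epsilon> :: real assume "\<epsilon> > 0"
      then have "\<epsilon> / c > 0" using c by simp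
      obtain R \<delta> where R: "\<delta> > 0"
        "\<And>x t. \<lbrakk>x \<in> C; R < g x; 0 < t; t < \<delta>\<rbrakk> \<Longrightarrow> \<exists>u. dist u v < \<epsilon>/c \<and> x + t *\<^sub>R u \<in> C"
        using tangent_cone_alongD[OF v \<open>\<epsilon> / c > 0\<close>] by metis
      show "\<exists>R. \<exists>\<delta>>0. \<forall>x\<in>C. \<forall>t. R < g x \<longrightarrow> 0 < t \<longrightarrow> t < \<delta> \<longrightarrow>
          (\<exists>u. dist u (c *\<^sub>R v) < \<epsilon> \<and> x + t *\<^sub>R u \<in> C)"
      proof (rule exI[of _ R], rule exI[of _ "\<delta> / c"], intro conjI ballI allI impI)
        fix x t assume "x \<in> C" "R < g x" "0 < t" "t < \<delta> / c"
        then obtain u where u: "dist u v < \<epsilon>/c" "x + (t * c) *\<^sub>R u \<in> C"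
          using R(2)[of x "t * c"] c by (auto simp: field_simps)
        have "dist (c *\<^sub>R u) (c *\<^sub>R v) = c * dist u v"
          using c by (simp add: dist_norm flip: scaleR_diff_right)
        with u c show "\<exists>u. dist u (c *\<^sub>R v) < \<epsilon> \<and> x + t *\<^sub>R u \<in> C"
          by (intro exI[of _ "c *\<^sub>R u"]) (auto simp: field_simps)
      qed (use R c in auto)
    qed
  qed
qed

section \<open>Interior tangent directions\<close>

text \<open>Here \<open>y\<close> is a point of \<open>C\<close> nearest to \<open>z\<close>, so
  \<open>z - y\<close> is a proximal normal. With \<open>w\<close> near \<open>u\<close> and
  \<open>y + t *\<^sub>R w\<close> in \<open>C\<close>, that point is no closer to \<open>z\<close>;
  squaring bounds twice the inner product of \<open>z - y\<close> and \<open>w\<close> by t times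
  the squared norm of \<open>w\<close>, and t is arbitrarily small. The threshold depends on neither
  \<open>y\<close> nor \<open>z\<close>.\<close>

lemma inner_proximal_normal_le:
  fixes C :: "'a::real_inner set"
  assumes u: "u \<in> tangent_cone_along g C" and "\<epsilon> > 0"
  shows "\<exists>R. \<forall>y\<in>C. R < g y \<longrightarrow>
    (\<forall>z. (\<forall>c\<in>C. dist z y \<le> dist z c) \<longrightarrow> (z - y) \<bullet> u \<le> \<epsilon> * norm (z - y))"
proof -
  obtain R \<delta> where R: "\<delta> > 0"
    "\<And>x t. \<lbrakk>x \<in> C; R < g x; 0 < t; t < \<delta>\<rbrakk> \<Longrightarrow> \<exists>w. dist w u < \<epsilon> \<and> x + t *\<^sub>R w \<in> C"
    using tangent_cone_alongD[OF u \<open>\<epsilon> > 0\<close>] by metis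
  define M where "M = norm u + \<epsilon>"
  have M: "M > 0" using \<open>\<epsilon> > 0\<close> by (simp add: M_def add_nonneg_pos)
  show ?thesis
  proof (intro exI[of _ R] ballI impI allI)
    fix y z assume y: "y \<in> C" "R < g y" and z: "\<forall>c\<in>C. dist z y \<le> dist z c"
    define n where "n = z - y"
    show "(z - y) \<bullet> u \<le> \<epsilon> * norm (z - y)"
      unfolding n_def[symmetric]
    proof (rule field_le_epsilon)
      fix e :: real assume "e > 0"
      \<comment> \<open>Since \<open>M\<close> bounds the norm of every \<open>w\<close> that can
        occur, this step makes the second-order term at most \<open>e\<close>.\<close>
      define t where "t = min (\<delta>/2) (e / M\<^sup>2)"
      have t: "0 < t" "t < \<delta>" "t * M\<^sup>2 \<le> e"
        using R(1) M \<open>e > 0\<close> by (auto simp: t_def min_def field_simps)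
      then obtain w where w: "dist w u < \<epsilon>" "y + t *\<^sub>R w \<in> C" using R(2) y by blast
      have "norm w \<le> M"
        using w(1) norm_triangle_ineq[of u "w - u"] by (simp add: dist_norm M_def)
      then have "norm w ^ 2 \<le> M\<^sup>2" by (simp add: power_mono)
      then have 1: "t * norm w ^ 2 \<le> e" using t by (smt (verit) mult_left_mono)
      have "norm n \<le> norm (n - t *\<^sub>R w)"
        using z w(2) by (auto simp: n_def dist_norm algebra_simps)
      then have "n \<bullet> n \<le> (n - t *\<^sub>R w) \<bullet> (n - t *\<^sub>R w)"
        by (simp add: norm_le)
      then have "t * (2 * (n \<bullet> w)) \<le> t * (t * norm w ^ 2)"
        by (simp add: power2_norm_eq_inner algebra_simps inner_commute)
      then have 2: "2 * (n \<bullet> w) \<le> e" using t 1 by simp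
      have "n \<bullet> (u - w) \<le> norm n * norm (u - w)" by (rule norm_cauchy_schwarz)
      also have "\<dots> \<le> norm n * \<epsilon>"
        using w(1) by (intro mult_left_mono) (auto simp: dist_norm norm_minus_commute)
      finally show "n \<bullet> u \<le> \<epsilon> * norm n + e"
        using 2 \<open>e > 0\<close> by (simp add: inner_diff_right mult.commute)
    qed
  qed
qed

lemma inner_sgn_self: "x \<bullet> sgn x = norm (x::'a::real_inner)"
  by (cases "x = 0") (simp_all add: sgn_div_norm power2_eq_square flip: power2_norm_eq_inner)

text \<open>The previous threshold depends on the direction. A finite r/4-net of a compact ball of
  tangent directions gives a common one, and the room left in the ball absorbs the errors.\<close>

lemma inner_proximal_normal_nonpos:
  fixes C :: "'a::euclidean_space set"
  assumes "v \<in> interior (tangent_cone_along g C)"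
  shows "\<exists>\<eta>>0. \<exists>R. \<forall>w y z. dist w v < \<eta> \<longrightarrow> y \<in> C \<longrightarrow> R < g y \<longrightarrow>
    (\<forall>c\<in>C. dist z y \<le> dist z c) \<longrightarrow> (z - y) \<bullet> w \<le> 0"
proof -
  obtain r where r: "r > 0" "cball v r \<subseteq> tangent_cone_along g C"
    using assms by (auto simp: mem_interior_cball)
  obtain K where K: "finite K" "K \<subseteq> cball v r" "cball v r \<subseteq> (\<Union>u\<in>K. ball u (r/4))"
    using seq_compact_imp_totally_bounded[OF compact_imp_seq_compact[OF compact_cball[of v r]],
        rule_format, of "r/4"] r(1) by auto
  have "\<exists>R. \<forall>y\<in>C. R < g y \<longrightarrow>
    (\<forall>z. (\<forall>c\<in>C. dist z y \<le> dist z c) \<longrightarrow> (z - y) \<bullet> u \<le> r/4 * norm (z - y))" if "u \<in> K" for u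
    using that r K(2) by (intro inner_proximal_normal_le) auto
  then obtain \<rho> where \<rho>: "\<And>u y z. \<lbrakk>u \<in> K; y \<in> C; \<rho> u < g y; \<forall>c\<in>C. dist z y \<le> dist z c\<rbrakk> \<Longrightarrow>
      (z - y) \<bullet> u \<le> r/4 * norm (z - y)" by metis
  \<comment> \<open>Inserting 0 keeps \<open>Max\<close> meaningful without a proof that
    \<open>K\<close> is nonempty.\<close>
  define R where "R = Max (insert 0 (\<rho> ` K))"
  have R: "\<rho> u \<le> R" if "u \<in> K" for u using that K(1) by (auto simp: R_def)
  show ?thesis
  proof (rule exI[of _ "r/2"], rule conjI[OF _ exI[of _ R]], goal_cases)
    case 2
    show ?case
    proof (intro allI impI)
      fix w y z assume w: "dist w v < r/2" and y: "y \<in> C" "R < g y"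
        and z: "\<forall>c\<in>C. dist z y \<le> dist z c"
      define n where "n = z - y"
      have "n \<bullet> w \<le> 0"
      proof (cases "n = 0")
        case False
        \<comment> \<open>Shifting \<open>w\<close> by r/2 towards the normal stays in the ball and
          adds r/2 times \<open>norm n\<close> to the inner product, exactly the sum of the two
          errors of r/4: the net distance and the estimate at the net point.\<close>
        define u0 where "u0 = w + (r/2) *\<^sub>R sgn n"
        have "dist v u0 \<le> dist v w + dist w u0" by (rule dist_triangle)
        also have "dist w u0 = r/2" using False r by (simp add: u0_def dist_norm norm_sgn)
        finally have "u0 \<in> cball v r" using w by (simp add: dist_commute)
        then obtain u where u: "u \<in> K" "dist u u0 < r/4" using K(3) by auto
        have 1: "n \<bullet> u \<le> r/4 * norm n"
          using \<rho>[OF u(1) y(1) _ z] R[OF u(1)] y(2) by (simp add: n_def)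
        have "n \<bullet> (u0 - u) \<le> norm n * norm (u0 - u)" by (rule norm_cauchy_schwarz)
        also have "\<dots> \<le> norm n * (r/4)"
          using u(2) by (intro mult_left_mono) (auto simp: dist_norm norm_minus_commute)
        finally have "n \<bullet> u0 \<le> r/2 * norm n" using 1 by (simp add: inner_diff_right mult.commute)
        then show ?thesis by (simp add: u0_def inner_add_right inner_sgn_self)
      qed simp
      then show "(z - y) \<bullet> w \<le> 0" by (simp add: n_def)
    qed
  qed (use r in simp)
qed

text \<open>An analogue at infinity of Rockafellar's theorem that interior tangent directions are
  hypertangent: moving in such a direction, the squared distance to \<open>C\<close> grows only to second
  order in the step size, hence it vanishes identically.\<close>

lemma interior_tangent_cone_alongE:
  fixes C :: "'a::euclidean_space set"
  assumes "closed C" and g: "\<And>x y. g x \<le> g y + norm (x - y)"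
    and "v \<in> interior (tangent_cone_along g C)"
  obtains \<eta> R where "\<eta> > 0"
    "\<And>x t w. \<lbrakk>x \<in> C; R < g x; 0 < t; t < 1; dist w v < \<eta>\<rbrakk> \<Longrightarrow> x + t *\<^sub>R w \<in> C"
proof -
  obtain \<eta> R where "\<eta> > 0" and R: "\<And>w y z. \<lbrakk>dist w v < \<eta>; y \<in> C; R < g y;
      \<forall>c\<in>C. dist z y \<le> dist z c\<rbrakk> \<Longrightarrow> (z - y) \<bullet> w \<le> 0"
    using inner_proximal_normal_nonpos[OF assms(3)] by blast
  \<comment> \<open>Every point of the segment followed has its nearest point in \<open>C\<close>
    within \<open>2 * (norm v + \<eta>)\<close> of \<open>x\<close>; the raised threshold keeps
    these nearest points beyond \<open>R\<close>.\<close>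
  have "x + t *\<^sub>R w \<in> C"
    if x: "x \<in> C" "R + 2 * (norm v + \<eta>) < g x" and t: "0 < t" "t < 1" and w: "dist w v < \<eta>"
    for x t w
  proof -
    define p where "p = t *\<^sub>R w"
    define d where "d s = infdist (x + s *\<^sub>R p) C" for s
    have "norm w \<le> norm v + \<eta>"
      using w norm_triangle_ineq[of v "w - v"] by (simp add: dist_norm)
    moreover have "norm p \<le> 1 * norm w" unfolding p_def using t by (simp add: mult_left_le_one_le)
    ultimately have p: "norm p \<le> norm v + \<eta>" by simp
    \<comment> \<open>Expand the squared distance to the point \<open>y\<close> of \<open>C\<close>
      nearest to the current position: the cross term is nonpositive because \<open>z - y\<close> is
      a proximal normal.\<close>
    have step: "(d (s + h))\<^sup>2 \<le> (d s)\<^sup>2 + h\<^sup>2 * (norm p)\<^sup>2" if s: "0 \<le> s" "s \<le> 1" and h: "0 \<le> h" for s h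
    proof -
      define z where "z = x + s *\<^sub>R p"
      obtain y where y: "y \<in> C" "\<And>c. c \<in> C \<Longrightarrow> dist z y \<le> dist z c"
        using distance_attains_inf[OF \<open>closed C\<close>, of z] x(1) by blast
      have dy: "d s = dist z y"
        unfolding d_def z_def[symmetric] infdist_def using y
        by (auto intro!: antisym cINF_lower2[of _ _ y] cINF_greatest bdd_belowI2[of _ 0])
      have "dist z y \<le> norm (s *\<^sub>R p)" using y(2)[OF x(1)] by (simp add: z_def dist_norm)
      also have "\<dots> \<le> norm p" using s by (simp add: mult_left_le_one_le)
      finally have "dist z y \<le> norm p" .
      moreover have "dist x z \<le> norm p" using s by (simp add: z_def dist_norm mult_left_le_one_le)
      ultimately have "norm (x - y) \<le> 2 * norm p"
        using dist_triangle[of x y z] by (simp add: dist_norm)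
      then have "R < g y" using g[of x y] x(2) p by simp
      then have "(z - y) \<bullet> p \<le> 0"
        using R[OF w y(1)] y(2) t by (simp add: p_def mult_nonneg_nonpos)
      then have "2 * h * ((z - y) \<bullet> p) \<le> 0" using h by (simp add: mult_nonneg_nonpos)
      moreover have "d (s + h) \<le> norm ((z - y) + h *\<^sub>R p)"
        using infdist_le[OF y(1), of "x + (s + h) *\<^sub>R p"]
        by (simp add: d_def z_def dist_norm algebra_simps)
      then have "(d (s + h))\<^sup>2 \<le> (norm ((z - y) + h *\<^sub>R p))\<^sup>2"
        by (intro power_mono) (auto simp: d_def infdist_nonneg)
      moreover have "(norm ((z - y) + h *\<^sub>R p))\<^sup>2
          = (norm (z - y))\<^sup>2 + 2 * h * ((z - y) \<bullet> p) + h\<^sup>2 * (norm p)\<^sup>2"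
        using dot_norm[of "z - y" "h *\<^sub>R p"] by (simp add: power_mult_distrib)
      ultimately show ?thesis by (simp add: dy dist_norm)
    qed
    \<comment> \<open>Each of N steps of length 1/N adds at most the squared norm of
      \<open>p\<close> over N squared, so the total at parameter 1 is of order 1/N and vanishes in
      the limit.\<close>
    have bound: "(d (real k / real N))\<^sup>2 \<le> real k * ((norm p)\<^sup>2 / (real N)\<^sup>2)"
      if "k \<le> N" "N > 0" for k N
      using that(1)
    proof (induction k)
      case 0
      then show ?case using x(1) by (simp add: d_def)
    next
      case (Suc k)
      have "real (Suc k) / real N = real k / real N + 1 / real N" by (simp add: add_divide_distrib)
      then have "(d (real (Suc k) / real N))\<^sup>2
          \<le> (d (real k / real N))\<^sup>2 + (1 / real N)\<^sup>2 * (norm p)\<^sup>2"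
        using step[of "real k / real N" "1 / real N"] Suc.prems by simp
      with Suc show ?case by (simp add: power_divide algebra_simps add_divide_distrib)
    qed
    have "(d 1)\<^sup>2 \<le> 0 + e" if "e > 0" for e
    proof -
      obtain N :: nat where N: "(norm p)\<^sup>2 / e < real N" using reals_Archimedean2 by blast
      have "0 \<le> (norm p)\<^sup>2 / e" using that by simp
      with N have "N > 0" by (metis le_less_trans of_nat_0_less_iff)
      have "(d 1)\<^sup>2 \<le> (norm p)\<^sup>2 / real N"
        using bound[of N N] \<open>N > 0\<close> by (simp add: power2_eq_square)
      also have "\<dots> \<le> e" using N that \<open>N > 0\<close> by (simp add: field_simps)
      finally show ?thesis by simp
    qed
    then have "(d 1)\<^sup>2 \<le> 0" by (rule field_le_epsilon)
    then have "infdist (x + t *\<^sub>R w) C = 0" by (simp add: d_def p_def)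
    then show ?thesis using in_closed_iff_infdist_zero[OF \<open>closed C\<close>] x(1) by auto
  qed
  then show ?thesis using that \<open>\<eta> > 0\<close> by blast
qed

section \<open>Epigraphs\<close>

lemma closed_epi:
  fixes f :: "'a::first_countable_topology \<Rightarrow> ereal"
  assumes "lower_semicontinuous f"
  shows "closed (epi f)"
  unfolding closed_sequential_limits
proof (intro allI impI)
  fix p and l :: "'a \<times> real" assume p: "(\<forall>n. p n \<in> epi f) \<and> p \<longlonglongrightarrow> l"
  show "l \<in> epi f"
  proof (rule ccontr)
    assume "l \<notin> epi f"
    then have "ereal (snd l) < f (fst l)" by (auto simp: epi_def not_le split: prod.splits)
    \<comment> \<open>Lower semicontinuity keeps \<open>f\<close> above this intermediate level near
      the limit, while the heights of the sequence eventually fall below it.\<close>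
    then obtain c where c: "ereal (snd l) < c" "c < f (fst l)" using dense by blast
    have "eventually (\<lambda>x. c < f x) (nhds (fst l))"
      using assms c(2) unfolding lower_semicontinuous_def
      by (intro less_LiminfD) (blast intro: less_le_trans)
    moreover have "(\<lambda>n. fst (p n)) \<longlonglongrightarrow> fst l" using p by (auto intro: tendsto_fst)
    ultimately have "eventually (\<lambda>n. c < f (fst (p n))) sequentially"
      by (rule eventually_compose_filterlim)
    moreover have "eventually (\<lambda>n. ereal (snd (p n)) < c) sequentially"
      using p c(1) by (intro order_tendstoD(2)[of _ "ereal (snd l)"]) (auto intro: tendsto_snd)
    ultimately have "eventually (\<lambda>n. False) sequentially"
    proof eventually_elim
      case (elim n)
      have "f (fst (p n)) \<le> ereal (snd (p n))"
        using p by (auto simp: epi_def split: prod.splits dest!: spec[of _ n])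
      with elim show ?case by (meson leD less_trans)
    qed
    then show False by simp
  qed
qed

text \<open>The limit over the radii is a supremum, so the upper limit is below \<open>r\<close> for
  each radius. This gives uniform bounds on \<open>x\<close> and \<open>t\<close>, and the infimum
  gives a nearby \<open>w\<close> with quotient below \<open>r\<close>. The direction
  \<open>(w, r)\<close> then works from every height above \<open>f x\<close>.\<close>

lemma tangent_cone_epi_if_upper_subderiv_less:
  fixes f :: "'a::real_inner \<Rightarrow> ereal"
  assumes ninf: "\<And>x. f x \<noteq> -\<infinity>" and less: "upper_subderiv_inf f v < ereal r"
  shows "(v, r) \<in> tangent_cone_inf_fst (epi f)"
  unfolding tangent_cone_inf_fst_eq_along tangent_cone_along_def
proof (intro CollectI allI impI)
  fix \<epsilon> :: real assume "\<epsilon> > 0"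
  \<comment> \<open>The subderivative uses closed balls, the cone a strict distance bound.\<close>
  define \<epsilon>' where "\<epsilon>' = \<epsilon> / 2"
  have e: "\<epsilon>' > 0" "\<epsilon>' < \<epsilon>" using \<open>\<epsilon> > 0\<close> by (auto simp: \<epsilon>'_def)
  have "upper_subderiv_inf_at f v \<epsilon>' \<le> upper_subderiv_inf f v"
    unfolding upper_subderiv_inf_eq_SUP using e by (intro SUP_upper) auto
  with less have "upper_subderiv_inf_at f v \<epsilon>' < ereal r" by simp
  from Limsup_lessD[OF this[unfolded upper_subderiv_inf_at_def]]
  obtain P Q where P: "eventually P (inf at_infinity (principal (eff_dom f)))"
    and Q: "eventually Q (at_right (0::real))"
    and PQ: "\<And>x t. P x \<Longrightarrow> Q t \<Longrightarrow> (INF w\<in>cball v \<epsilon>'. (f (x + t *\<^sub>R w) - f x) / ereal t) < ereal r"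
    unfolding eventually_prod_filter by auto
  obtain R where R: "\<And>x. R \<le> norm x \<Longrightarrow> x \<in> eff_dom f \<Longrightarrow> P x"
    using P unfolding eventually_inf_principal eventually_at_infinity by blast
  obtain \<delta> where \<delta>: "\<delta> > 0" "\<And>t. 0 < t \<Longrightarrow> t < \<delta> \<Longrightarrow> Q t"
    using Q unfolding eventually_at_right_field by blast
  show "\<exists>R. \<exists>\<delta>>0. \<forall>x\<in>epi f. \<forall>t. R < norm (fst x) \<longrightarrow> 0 < t \<longrightarrow> t < \<delta> \<longrightarrow>
      (\<exists>u. dist u (v, r) < \<epsilon> \<and> x + t *\<^sub>R u \<in> epi f)"
  proof (rule exI[of _ R], rule exI[of _ \<delta>], intro conjI ballI allI impI)
    fix p :: "'a \<times> real" and t :: real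
    assume p: "p \<in> epi f" "R < norm (fst p)" and t: "0 < t" "t < \<delta>"
    obtain x y where xy: "p = (x, y)" by fastforce
    with p have fx: "f x \<le> ereal y" by (simp add: epi_def)
    then have "x \<in> eff_dom f" by (auto simp: eff_dom_def)
    then have "(INF w\<in>cball v \<epsilon>'. (f (x + t *\<^sub>R w) - f x) / ereal t) < ereal r"
      using R \<delta> t p(2) xy by (intro PQ) auto
    then obtain w where w: "w \<in> cball v \<epsilon>'" "(f (x + t *\<^sub>R w) - f x) / ereal t < ereal r"
      by (auto simp: INF_less_iff)
    obtain a where a: "f x = ereal a" using fx ninf[of x] by (cases "f x") auto
    have "f (x + t *\<^sub>R w) \<le> ereal (y + t * r)"
      using w(2) t fx a ninf[of "x + t *\<^sub>R w"]
      by (cases "f (x + t *\<^sub>R w)") (auto simp: field_simps)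
    then have "p + t *\<^sub>R (w, r) \<in> epi f" by (simp add: xy epi_def)
    moreover have "dist (w, r) (v, r) < \<epsilon>" using w(1) e by (simp add: dist_Pair_Pair dist_commute)
    ultimately show "\<exists>u. dist u (v, r) < \<epsilon> \<and> p + t *\<^sub>R u \<in> epi f" by blast
  qed (use \<delta> in auto)
qed


lemma convex_cone_tangent_cone_inf: "convex_cone (tangent_cone_inf C)"
  unfolding tangent_cone_inf_eq_along
  by (intro convex_cone_tangent_cone_along norm_triangle_sub)

lemma norm_fst_le_add: "norm (fst x) \<le> norm (fst y) + norm (x - y)"
  using norm_triangle_ineq[of "fst y" "fst x - fst y"] dist_fst_le[of x y] by (simp add: dist_norm)

lemma convex_cone_tangent_cone_inf_fst: "convex_cone (tangent_cone_inf_fst E)"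
  unfolding tangent_cone_inf_fst_eq_along
  by (intro convex_cone_tangent_cone_along norm_fst_le_add)

lemma vertical_in_tangent_cone_epi:
  fixes f :: "'a::real_normed_vector \<Rightarrow> ereal"
  shows "(0, 1) \<in> tangent_cone_inf_fst (epi f)"
  unfolding tangent_cone_inf_fst_eq_along tangent_cone_along_def
  by (auto simp: epi_def elim!: order_trans intro!: exI[of _ "0::'a"] exI[of _ "1::real"])

section \<open>Convex cones\<close>

text \<open>Translating and dilating \<open>interior T\<close> gives an open set, which stays inside
  \<open>T\<close> because \<open>T\<close> is closed under sums and multiples.\<close>

lemma convex_cone_add_interior:
  fixes T :: "'a::real_normed_vector set"
  assumes T: "convex_cone T" and "v \<in> T" "w \<in> interior T" "s > 0"
  shows "v + s *\<^sub>R w \<in> interior T"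
proof (rule interiorI)
  show "open ((\<lambda>u. v + s *\<^sub>R u) ` interior T)" using \<open>s > 0\<close> by (intro open_affinity) auto
  show "(\<lambda>u. v + s *\<^sub>R u) ` interior T \<subseteq> T"
    using assms interior_subset[of T]
    by (auto intro!: convex_cone_add[OF T] convex_cone_scaleR[OF T])
qed (use assms in auto)

text \<open>Once \<open>E\<close> has nonempty interior, taking interiors commutes with the
  projection, as for relative interiors of convex sets.\<close>

lemma mem_interior_fst_image:
  fixes E :: "('a::euclidean_space \<times> real) set"
  assumes E: "convex_cone E" "(0, 1) \<in> E" and v: "v \<in> interior (fst ` E)"
  shows "\<exists>r. (v, r) \<in> interior E"
proof -
  have cvx: "convex E" using E by (simp add: convex_cone_def)
  have "interior E \<noteq> {}"
  proof
    \<comment> \<open>A hyperplane containing \<open>E\<close> passes through 0 and contains the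
      vertical direction, so it projects to a hyperplane containing the projection of
      \<open>E\<close>, which has an interior point.\<close>
    assume "interior E = {}"
    then obtain a b where ab: "a \<noteq> 0" "E \<subseteq> {x. a \<bullet> x = b}"
      using empty_interior_subset_hyperplane[OF cvx] by metis
    then have "b = 0" using convex_cone_contains_0[OF E(1)] by auto
    then have "snd a = 0" using ab(2) E(2) by (auto simp: inner_prod_def)
    then have "fst ` E \<subseteq> {x. fst a \<bullet> x = 0}" using ab(2) \<open>b = 0\<close> by (auto simp: inner_prod_def)
    moreover have "fst a \<noteq> 0" using ab(1) \<open>snd a = 0\<close> by (simp add: prod_eq_iff)
    ultimately have "interior (fst ` E) = {}"
      using interior_mono[of "fst ` E" "{x. fst a \<bullet> x = 0}"] by (simp add: interior_hyperplane)
    then show False using v by simp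
  qed
  then have "interior (fst ` E) = fst ` interior E"
    using rel_interior_convex_linear_image[OF linear_fst cvx] rel_interior_nonempty_interior v
    by (metis empty_iff)
  then show ?thesis using v by auto
qed

text \<open>The cones \<open>E\<close> and \<open>T \<times> {..<0}\<close> are disjoint; the qualification excludes a vertical
  separating hyperplane.\<close>

lemma convex_cone_separation:
  fixes E :: "('a::euclidean_space \<times> real) set" and T :: "'a set"
  assumes E: "convex_cone E" "(0, 1) \<in> E" and T: "convex_cone T"
    and cq: "fst ` E \<inter> interior T \<noteq> {} \<or> interior (fst ` E) \<inter> T \<noteq> {}"
    and nonneg: "\<And>v r. (v, r) \<in> E \<Longrightarrow> v \<in> T \<Longrightarrow> 0 \<le> r"
  shows "\<exists>\<xi>. (\<forall>z\<in>E. z \<bullet> (\<xi>, -1) \<le> 0) \<and> (\<forall>v\<in>T. 0 \<le> v \<bullet> \<xi>)"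
proof -
  have "\<exists>a b. a \<noteq> 0 \<and> (\<forall>x\<in>E. a \<bullet> x \<le> b) \<and> (\<forall>x\<in>T \<times> {..<0::real}. b \<le> a \<bullet> x)"
  proof (rule separating_hyperplane_sets)
    show "convex (T \<times> {..<0::real})"
      using T by (auto simp: convex_cone_def intro: convex_Times)
    show "E \<inter> T \<times> {..<0} = {}" using nonneg by force
    have "(0, -1) \<in> T \<times> {..<0::real}" using convex_cone_contains_0[OF T] by simp
    then show "T \<times> {..<0::real} \<noteq> {}" by blast
  qed (use E in \<open>auto simp: convex_cone_def\<close>)
  then obtain \<zeta> c b where a: "(\<zeta>, c) \<noteq> 0" "\<And>x. x \<in> E \<Longrightarrow> (\<zeta>, c) \<bullet> x \<le> b"
    "\<And>v r. v \<in> T \<Longrightarrow> r < 0 \<Longrightarrow> b \<le> (\<zeta>, c) \<bullet> (v, r)" by (fastforce simp: split_paired_Ex)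
  have "b \<ge> 0" using a(2)[OF convex_cone_contains_0[OF E(1)]] by simp
  \<comment> \<open>A linear functional bounded above on a cone is nonpositive there: otherwise a
    multiple of \<open>x\<close> attains b + 1.\<close>
  have Epos: "(\<zeta>, c) \<bullet> x \<le> 0" if "x \<in> E" for x
  proof (rule ccontr)
    assume pos: "\<not> (\<zeta>, c) \<bullet> x \<le> 0"
    define q where "q = (\<zeta>, c) \<bullet> x"
    have q: "q > 0" using pos by (simp only: q_def not_le)
    have "((b + 1) / q) *\<^sub>R x \<in> E"
      using q \<open>b \<ge> 0\<close> that by (intro convex_cone_scaleR[OF E(1)]) auto
    from a(2)[OF this] have "(b + 1) / q * q \<le> b" by (simp only: inner_scaleR_right q_def)
    then show False using q by simp
  qed
  have "c \<le> 0" using Epos[OF E(2)] by simp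
  \<comment> \<open>Let the negative height tend to 0; the chosen height makes its contribution at
    most \<open>e\<close>.\<close>
  have Tpos: "0 \<le> v \<bullet> \<zeta>" if "v \<in> T" for v
  proof (rule field_le_epsilon)
    fix e :: real assume "e > 0"
    have "0 \<le> \<zeta> \<bullet> v + c * (- (e / (1 + \<bar>c\<bar>)))"
      using a(3)[OF that, of "- (e / (1 + \<bar>c\<bar>))"] \<open>e > 0\<close> \<open>b \<ge> 0\<close> by (simp add: add_pos_nonneg)
    also have "c * (- (e / (1 + \<bar>c\<bar>))) \<le> e"
      using \<open>c \<le> 0\<close> \<open>e > 0\<close> by (simp add: field_simps)
    finally show "0 \<le> v \<bullet> \<zeta> + e" by (simp add: inner_commute)
  qed
  \<comment> \<open>If c = 0, then \<open>\<zeta>\<close> is nonpositive on the projection of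
    \<open>E\<close> and nonnegative on \<open>T\<close>. At a common point interior to one of them,
    moving by r along the unit vector of \<open>\<zeta>\<close>, with the suitable sign, violates
    one of the two inequalities.\<close>
  have "c \<noteq> 0"
  proof
    assume "c = 0"
    then have "\<zeta> \<noteq> 0" using a(1) by (simp add: prod_eq_iff)
    have Epos': "\<zeta> \<bullet> v \<le> 0" if "v \<in> fst ` E" for v
      using that Epos \<open>c = 0\<close> by (auto simp: inner_prod_def)
    from cq show False
    proof
      assume "fst ` E \<inter> interior T \<noteq> {}"
      then obtain v where v: "v \<in> fst ` E" "v \<in> interior T" by blast
      then obtain r where r: "r > 0" "cball v r \<subseteq> T" by (auto simp: mem_interior_cball)
      have "v - r *\<^sub>R sgn \<zeta> \<in> T"
        using r \<open>\<zeta> \<noteq> 0\<close> by (intro subsetD[OF r(2)]) (simp add: dist_norm norm_sgn)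
      from Tpos[OF this] have "r * norm \<zeta> \<le> \<zeta> \<bullet> v"
        by (simp add: inner_diff_right inner_commute[of _ \<zeta>] inner_sgn_self)
      then have "r * norm \<zeta> \<le> 0" using Epos'[OF v(1)] by simp
      then show False using r(1) \<open>\<zeta> \<noteq> 0\<close> by (simp add: mult_le_0_iff)
    next
      assume "interior (fst ` E) \<inter> T \<noteq> {}"
      then obtain v where v: "v \<in> T" "v \<in> interior (fst ` E)" by blast
      then obtain r where r: "r > 0" "cball v r \<subseteq> fst ` E" by (auto simp: mem_interior_cball)
      have "v + r *\<^sub>R sgn \<zeta> \<in> fst ` E"
        using r \<open>\<zeta> \<noteq> 0\<close> by (intro subsetD[OF r(2)]) (simp add: dist_norm norm_sgn)
      from Epos'[OF this] have "r * norm \<zeta> + \<zeta> \<bullet> v \<le> 0"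
        by (simp add: inner_add_right inner_sgn_self)
      then have "r * norm \<zeta> \<le> 0" using Tpos[OF v(1)] by (simp add: inner_commute)
      then show False using r(1) \<open>\<zeta> \<noteq> 0\<close> by (simp add: mult_le_0_iff)
    qed
  qed
  with \<open>c \<le> 0\<close> have c: "c < 0" by simp
  show ?thesis
  \<comment> \<open>Dividing by -c > 0 normalizes the last coordinate to -1.\<close>
  proof (intro exI[of _ "(- 1 / c) *\<^sub>R \<zeta>"] conjI ballI)
    fix z assume "z \<in> E"
    have "((- 1 / c) *\<^sub>R \<zeta>, - 1) = (- 1 / c) *\<^sub>R (\<zeta>, c)" using c by simp
    then have "z \<bullet> ((- 1 / c) *\<^sub>R \<zeta>, - 1) = (- 1 / c) * ((\<zeta>, c) \<bullet> z)"
      by (simp only: inner_scaleR_right inner_commute)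
    then show "z \<bullet> ((- 1 / c) *\<^sub>R \<zeta>, - 1) \<le> 0"
      using Epos[OF \<open>z \<in> E\<close>] c by (simp add: mult_nonneg_nonpos divide_nonpos_neg)
  next
    fix v assume "v \<in> T"
    then show "0 \<le> v \<bullet> (- 1 / c) *\<^sub>R \<zeta>" using Tpos c by (simp add: divide_nonneg_neg)
  qed
qed

section \<open>Optimality at infinity\<close>

text \<open>One step of fixed length lowers \<open>f\<close> by a fixed amount, whereas far out on
  the sequence the excess of \<open>f\<close> over its lower bound \<open>m\<close> is smaller than
  that amount.\<close>

lemma no_uniform_descent:
  fixes f :: "'a::real_normed_vector \<Rightarrow> ereal"
  assumes lower: "\<And>x. x \<in> C \<Longrightarrow> ereal m \<le> f x"
    and x: "\<And>k. x k \<in> C" "filterlim (\<lambda>k. norm (x k)) at_top sequentially"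
      "(\<lambda>k. f (x k)) \<longlonglongrightarrow> ereal m"
    and "s < 0" "\<delta> > 0"
    and descent: "\<And>x y t. \<lbrakk>x \<in> C; f x \<le> ereal y; R < norm x; 0 < t; t < \<delta>\<rbrakk> \<Longrightarrow>
      \<exists>w. x + t *\<^sub>R w \<in> C \<and> f (x + t *\<^sub>R w) \<le> ereal (y + t * s)"
  shows False
proof -
  define t where "t = \<delta> / 2"
  have t: "0 < t" "t < \<delta>" using \<open>\<delta> > 0\<close> by (auto simp: t_def)
  have "ereal m < ereal (m - t * s)" using t \<open>s < 0\<close> by (simp add: mult_pos_neg)
  from order_tendstoD(2)[OF x(3) this]
  have "eventually (\<lambda>k. f (x k) < ereal (m - t * s)) sequentially" .
  moreover have "eventually (\<lambda>k. R < norm (x k)) sequentially"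
    using x(2) by (simp add: filterlim_at_top_dense)
  ultimately have "eventually (\<lambda>k. f (x k) < ereal (m - t * s) \<and> R < norm (x k)) sequentially"
    by (rule eventually_conj)
  then obtain k where k: "f (x k) < ereal (m - t * s)" "R < norm (x k)"
    using eventually_happens'[OF sequentially_bot] by blast
  obtain y where y: "f (x k) = ereal y"
    using k(1) lower[OF x(1)[of k]] by (cases "f (x k)") auto
  obtain w where w: "x k + t *\<^sub>R w \<in> C" "f (x k + t *\<^sub>R w) \<le> ereal (y + t * s)"
    using descent[OF x(1) eq_refl[OF y] k(2) t] by blast
  have "ereal m \<le> ereal (y + t * s)" using lower[OF w(1)] w(2) by (rule order_trans)
  then show False using k(1) y by simp
qed

lemma tangent_cone_epi_nonneg:
  fixes f :: "'a::euclidean_space \<Rightarrow> ereal" and C :: "'a set"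
  defines "E \<equiv> tangent_cone_inf_fst (epi f)" and "T \<equiv> tangent_cone_inf C"
  assumes lsc: "lower_semicontinuous f" and "closed C"
    and lower: "\<And>x. x \<in> C \<Longrightarrow> ereal m \<le> f x"
    and x: "\<And>k. x k \<in> C" "filterlim (\<lambda>k. norm (x k)) at_top sequentially"
      "(\<lambda>k. f (x k)) \<longlonglongrightarrow> ereal m"
    and cq: "fst ` E \<inter> interior T \<noteq> {} \<or> interior (fst ` E) \<inter> T \<noteq> {}"
    and v: "(v, r) \<in> E" "v \<in> T"
  shows "0 \<le> r"
proof (rule ccontr)
  assume "\<not> 0 \<le> r"
  have E: "convex_cone E" and T: "convex_cone T"
    by (auto simp: E_def T_def convex_cone_tangent_cone_inf_fst convex_cone_tangent_cone_inf)
  have small: "\<exists>s>0. r + s * r0 < 0" for r0 :: real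
  \<comment> \<open>The choice gives \<open>s * \<bar>r0\<bar> < - r\<close>.\<close>
  proof (intro exI[of _ "- r / (\<bar>r0\<bar> + 1)"] conjI)
    have "\<bar>r0\<bar> + 1 > 0" by simp
    then show "- r / (\<bar>r0\<bar> + 1) > 0" using \<open>\<not> 0 \<le> r\<close> by (intro divide_pos_pos) auto
    have "r * (\<bar>r0\<bar> + 1) - r * r0 < 0"
      using \<open>\<not> 0 \<le> r\<close> by (simp add: mult_less_0_iff flip: right_diff_distrib)
    then show "r + - r / (\<bar>r0\<bar> + 1) * r0 < 0" using \<open>\<bar>r0\<bar> + 1 > 0\<close> by (simp add: field_simps)
  qed
  have move: "(v + s *\<^sub>R v0, r + s * r0) = (v, r) + s *\<^sub>R (v0, r0)" for s v0 r0 by simp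
  from cq show False
  proof
    assume "fst ` E \<inter> interior T \<noteq> {}"
    then obtain v0 r0 where v0: "(v0, r0) \<in> E" "v0 \<in> interior T" by auto
    obtain s where s: "s > 0" "r + s * r0 < 0" using small by blast
    define v1 r1 where "v1 = v + s *\<^sub>R v0" and "r1 = r + s * r0"
    have E1: "(v1, r1) \<in> E"
      unfolding v1_def r1_def move using v v0 s
      by (intro convex_cone_add[OF E] convex_cone_scaleR[OF E]) auto
    have T1: "v1 \<in> interior T"
      unfolding v1_def using v v0 s by (intro convex_cone_add_interior[OF T])
    have "r1 < 0" using s by (simp add: r1_def)
    obtain \<eta> R1 where R1: "\<eta> > 0" "\<And>x t w. \<lbrakk>x \<in> C; R1 < norm x; 0 < t; t < 1; dist w v1 < \<eta>\<rbrakk>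
        \<Longrightarrow> x + t *\<^sub>R w \<in> C"
      using interior_tangent_cone_alongE[OF \<open>closed C\<close> norm_triangle_sub
          T1[unfolded T_def tangent_cone_inf_eq_along]]
      by metis
    \<comment> \<open>The first bound keeps the direction in the neighbourhood that can be followed
      in \<open>C\<close>; the second keeps its slope below \<open>r1 / 2\<close>.\<close>
    have "min \<eta> (- r1 / 2) > 0" using R1(1) \<open>r1 < 0\<close> by simp
    from tangent_cone_alongD[OF E1[unfolded E_def tangent_cone_inf_fst_eq_along] this]
    obtain R2 \<delta> where R2: "\<delta> > 0" "\<And>p t. \<lbrakk>p \<in> epi f; R2 < norm (fst p); 0 < t; t < \<delta>\<rbrakk> \<Longrightarrow>
        \<exists>u. dist u (v1, r1) < min \<eta> (- r1 / 2) \<and> p + t *\<^sub>R u \<in> epi f" by metis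
    show False
    proof (rule no_uniform_descent[OF lower x, of "r1/2" "min \<delta> 1" "max R1 R2"])
      fix x y t
      assume x: "x \<in> C" "f x \<le> ereal y" "max R1 R2 < norm x" and t: "0 < t" "t < min \<delta> 1"
      then obtain w q where u: "dist (w, q) (v1, r1) < min \<eta> (- r1 / 2)"
        "(x, y) + t *\<^sub>R (w, q) \<in> epi f"
        using R2(2)[of "(x, y)" t] by (auto simp: epi_def)
      have w: "dist w v1 < \<eta>" and q: "dist q r1 < - r1 / 2"
        using u(1) dist_fst_le[of "(w, q)" "(v1, r1)"] dist_snd_le[of "(w, q)" "(v1, r1)"] by auto
      have "t * q \<le> t * (r1 / 2)"
        using q t by (intro mult_left_mono) (auto simp: dist_real_def)
      then have "f (x + t *\<^sub>R w) \<le> ereal (y + t * (r1 / 2))"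
        using u(2) by (auto simp: epi_def elim!: order_trans)
      moreover have "x + t *\<^sub>R w \<in> C" using R1(2)[OF x(1) _ t(1) _ w] x(3) t(2) by simp
      ultimately show "\<exists>w. x + t *\<^sub>R w \<in> C \<and> f (x + t *\<^sub>R w) \<le> ereal (y + t * (r1 / 2))" by blast
    qed (use \<open>r1 < 0\<close> R2(1) in auto)
  next
    assume "interior (fst ` E) \<inter> T \<noteq> {}"
    then obtain v0 r0 where v0: "(v0, r0) \<in> interior E" "v0 \<in> T"
      using mem_interior_fst_image[OF E] vertical_in_tangent_cone_epi unfolding E_def by blast
    obtain s where s: "s > 0" "r + s * r0 < 0" using small by blast
    define v1 r1 where "v1 = v + s *\<^sub>R v0" and "r1 = r + s * r0"
    have E1: "(v1, r1) \<in> interior E"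
      unfolding v1_def r1_def move using v v0 s by (intro convex_cone_add_interior[OF E])
    have T1: "v1 \<in> T"
      unfolding v1_def using v v0 s
      by (intro convex_cone_add[OF T] convex_cone_scaleR[OF T]) auto
    have "r1 < 0" using s by (simp add: r1_def)
    obtain \<eta> R1 where R1: "\<eta> > 0" "\<And>p t u. \<lbrakk>p \<in> epi f; R1 < norm (fst p); 0 < t; t < 1;
        dist u (v1, r1) < \<eta>\<rbrakk> \<Longrightarrow> p + t *\<^sub>R u \<in> epi f"
      using interior_tangent_cone_alongE[OF closed_epi[OF lsc] norm_fst_le_add
          E1[unfolded E_def tangent_cone_inf_fst_eq_along]]
      by metis
    \<comment> \<open>The roles are exchanged: the direction now comes from \<open>C\<close> and is
      followed exactly in the epigraph, so the slope \<open>r1\<close> is attained without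
      loss.\<close>
    from tangent_cone_alongD[OF T1[unfolded T_def tangent_cone_inf_eq_along] R1(1)]
    obtain R2 \<delta> where R2: "\<delta> > 0" "\<And>x t. \<lbrakk>x \<in> C; R2 < norm x; 0 < t; t < \<delta>\<rbrakk> \<Longrightarrow>
        \<exists>w. dist w v1 < \<eta> \<and> x + t *\<^sub>R w \<in> C" by metis
    show False
    proof (rule no_uniform_descent[OF lower x, of r1 "min \<delta> 1" "max R1 R2"])
      fix x y t
      assume x: "x \<in> C" "f x \<le> ereal y" "max R1 R2 < norm x" and t: "0 < t" "t < min \<delta> 1"
      then obtain w where w: "dist w v1 < \<eta>" "x + t *\<^sub>R w \<in> C"
        using R2(2)[of x t] by auto
      have "(x, y) + t *\<^sub>R (w, r1) \<in> epi f"
        using x t w(1) by (intro R1(2)) (auto simp: epi_def dist_Pair_Pair)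
      then show "\<exists>w. x + t *\<^sub>R w \<in> C \<and> f (x + t *\<^sub>R w) \<le> ereal (y + t * r1)"
        using w(2) by (auto simp: epi_def)
    qed (use \<open>r1 < 0\<close> R2(1) in auto)
  qed
qed

theorem theorem4p14:
  fixes f :: "real ^ 'n \<Rightarrow> ereal" and C :: "(real ^ 'n) set"
  assumes "\<And>x. f x \<noteq> -\<infinity>"
    and "\<not> bounded (eff_dom f)"
    and "lower_semicontinuous f"
    and "closed C" and "\<not> bounded C"
    and "upper_subderiv_dom f \<inter> interior (tangent_cone_inf C) \<noteq> {} \<or>
         interior (upper_subderiv_dom f) \<inter> tangent_cone_inf C \<noteq> {}"
    and "\<exists>x. (\<forall>k. x k \<in> C) \<and> filterlim (\<lambda>k. norm (x k)) at_top sequentially \<and>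
           (\<lambda>k. f (x k)) \<longlonglongrightarrow> (INF x\<in>C. f x)"
    and "-\<infinity> < (INF x\<in>C. f x)" and "C \<inter> eff_dom f \<noteq> {}"
  shows "0 \<in> subdiff_inf f + normal_cone_inf C \<and>
         (\<forall>v\<in>tangent_cone_inf C. 0 \<le> upper_subderiv_inf f v)"
proof -
  let ?E = "tangent_cone_inf_fst (epi f)" and ?T = "tangent_cone_inf C"
  \<comment> \<open>A point of \<open>C\<close> in the effective domain makes the infimum
    finite.\<close>
  obtain c where c: "c \<in> C" "f c < \<infinity>" using assms(9) by (auto simp: eff_dom_def)
  then have "(INF x\<in>C. f x) < \<infinity>" by (meson INF_lower le_less_trans)
  then obtain m where m: "(INF x\<in>C. f x) = ereal m"
    using assms(8) by (cases "INF x\<in>C. f x") auto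
  have lower: "ereal m \<le> f x" if "x \<in> C" for x using that m by (metis INF_lower)
  obtain x where x: "\<And>k. x k \<in> C" "filterlim (\<lambda>k. norm (x k)) at_top sequentially"
    "(\<lambda>k. f (x k)) \<longlonglongrightarrow> ereal m" using assms(7) m by auto
  \<comment> \<open>This transfers both forms of the qualification to the projection of the epigraph
    cone.\<close>
  have "upper_subderiv_dom f \<subseteq> fst ` ?E"
  proof
    fix v assume "v \<in> upper_subderiv_dom f"
    then have "upper_subderiv_inf f v < \<infinity>" by (simp add: upper_subderiv_dom_def)
    then obtain r where "upper_subderiv_inf f v < ereal r" using less_PInf_Ex_of_nat by auto
    then have "(v, r) \<in> ?E" by (rule tangent_cone_epi_if_upper_subderiv_less[OF assms(1)])
    then show "v \<in> fst ` ?E" by force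
  qed
  then have cq: "fst ` ?E \<inter> interior ?T \<noteq> {} \<or> interior (fst ` ?E) \<inter> ?T \<noteq> {}"
    using assms(6) interior_mono[of "upper_subderiv_dom f" "fst ` ?E"] by blast
  have nonneg: "0 \<le> r" if "(v, r) \<in> ?E" "v \<in> ?T" for v r
    by (rule tangent_cone_epi_nonneg[OF assms(3,4) lower x cq that])
  have "\<exists>\<xi>. (\<forall>z\<in>?E. z \<bullet> (\<xi>, -1) \<le> 0) \<and> (\<forall>v\<in>?T. 0 \<le> v \<bullet> \<xi>)"
    by (rule convex_cone_separation[OF convex_cone_tangent_cone_inf_fst
          vertical_in_tangent_cone_epi convex_cone_tangent_cone_inf cq]) (rule nonneg)
  then obtain \<xi> where \<xi>: "\<And>z. z \<in> ?E \<Longrightarrow> z \<bullet> (\<xi>, -1) \<le> 0" "\<And>v. v \<in> ?T \<Longrightarrow> 0 \<le> v \<bullet> \<xi>"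
    by blast
  have "\<xi> \<in> subdiff_inf f"
    using \<xi>(1) by (simp add: subdiff_inf_def normal_cone_inf_fst_def polar_cone_def)
  moreover have "- \<xi> \<in> normal_cone_inf C"
    using \<xi>(2) by (simp add: normal_cone_inf_def polar_cone_def)
  ultimately have "\<xi> + - \<xi> \<in> subdiff_inf f + normal_cone_inf C" by (rule set_plus_intro)
  \<comment> \<open>A negative subderivative would leave room for a real \<open>r\<close> between it
    and 0, hence a tangent direction of the epigraph with negative slope over
    \<open>v\<close>.\<close>
  moreover have "0 \<le> upper_subderiv_inf f v" if "v \<in> ?T" for v
  proof (rule ccontr)
    assume "\<not> ?thesis"
    then obtain r where "upper_subderiv_inf f v < ereal r" "r < 0"
      using ereal_dense2[of "upper_subderiv_inf f v" 0] by (auto simp: not_le)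
    then show False
      using nonneg[OF tangent_cone_epi_if_upper_subderiv_less[OF assms(1)] that] by force
  qed
  ultimately show ?thesis by simp
qed

end
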